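(* Let $X$ be a metrizable, separable, locally compact space and let $\mathcal F=\{f_1,\dots,f_m\}$ be an iterated function system on $X$ with compact dynamics. Assume that the smallest stream $\mathcal A_{\mathcal F}$ of $\mathcal F$ has at most countably many nodes. Then $\mathcal A_{\mathcal F}=\mathcal C_{\mathcal F}$, where $\mathcal C_{\mathcal F}$ is the chain stream of $\mathcal F$.
   Context: Fix any metric $d$ on $X$ compatible with its topology. An iterated function system (IFS) on $X$ is a finite collection $\mathcal F=\{f_1,\dots,f_m\}$, $m\ge1$, of continuous maps $X\to X$. $\mathcal I^m$ is the set of all finite words in the letters $1,\dots,m$ (including the empty word $0$); $|I|$ is the length of $I$. For $I=i_1\cdots i_k$, $\Phi^I_{\mathcal F}=f_{i_k}\circ\dots\circ f_{i_1}$, and $\Phi^0_{\mathcal F}=\mathrm{id}_X$. $H_{\mathcal F}(A)=\bigcup_{i=1}^m f_i(A)$; $A$ is $H$-invariant if $H_{\mathcal F}(A)=A$. The orbit relation is $\mathcal O_{\mathcal F}=\{(x,\Phi^I_{\mathcal F}(x)):x\in X, I\in\mathcal I^m\}$. $N_\varepsilon(A)=\{x:d(x,A)<\varepsilon\}$. $A$ attracts $K$ if for every $\varepsilon>0$ there is $\tau>0$ with $\Phi^I_{\mathcal F}(K)\subset N_\varepsilon(A)$ for every $|I|\ge\tau$. A global attractor is a compact $H$-invariant set that attracts every compact subset of $X$. $\mathcal F$ has compact dynamics if it has a global attractor. A stream of $\mathcal F$ is a reflexive, transitive relation $S\subset X\times X$ that is closed in $X\times X$ and contains $\mathcal O_{\mathcal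 F}$. The intersection of all streams of $\mathcal F$ is a stream, the smallest stream, denoted $\mathcal A_{\mathcal F}$. For a stream $S$, points $x,y$ are $S$-equivalent if $(x,y)\in S$ and $(y,x)\in S$; $x$ is $S$-recurrent if $x$ is $S$-equivalent to $f_i(x)$ for some $i$; the nodes of $S$ are the $S$-equivalence classes of the set of $S$-recurrent points. An $\varepsilon$-chain from $x$ to $y$ is a finite sequence $x_0=x,x_1,\dots,x_k=y$ ($k\ge0$) in $X$ with indices $i_0,\dots,i_{k-1}$ such that $d(f_{i_n}(x_n),x_{n+1})<\varepsilon$ for $n=0,\dots,k-1$. The chain stream is $\mathcal C_{\mathcal F}=\{(x,y):$ for every $\varepsilon>0$ there is an $\varepsilon$-chain from $x$ to $y\}$. *)

theory Defs
  imports "HOL-Analysis.Analysis"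
begin

text \<open>
  An iterated function system \<open>f\<^sub>1, \<dots>, f\<^sub>m\<close> is given by the number \<open>m\<close> of maps and a family
  \<open>f :: nat \<Rightarrow> 'a \<Rightarrow> 'a\<close>, of which only the values at indices in \<open>{1..m}\<close> matter.
  The space is the whole type \<open>'a\<close>; its class instance \<open>metric_space\<close> is the fixed
  compatible metric.
\<close>

definition is_ifs :: "nat \<Rightarrow> (nat \<Rightarrow> 'a::metric_space \<Rightarrow> 'a) \<Rightarrow> bool" where
  "is_ifs m f \<longleftrightarrow> m \<ge> 1 \<and> (\<forall>i\<in>{1..m}. continuous_on UNIV (f i))"

definition ifs_words :: "nat \<Rightarrow> nat list set" where
  "ifs_words m = lists {1..m}"

text \<open>\<open>fold\<close> applies the letters from left to right, so the first letter of the word acts first.\<close>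

definition ifs_word_map :: "(nat \<Rightarrow> 'a \<Rightarrow> 'a) \<Rightarrow> nat list \<Rightarrow> 'a \<Rightarrow> 'a" where
  "ifs_word_map f I = fold f I"

lemma ifs_word_map_Nil: "ifs_word_map f [] = id"
  by (simp add: ifs_word_map_def id_def fun_eq_iff)

lemma ifs_word_map_snoc: "ifs_word_map f (I @ [i]) = f i \<circ> ifs_word_map f I"
  by (simp add: ifs_word_map_def fun_eq_iff)

definition hutchinson :: "nat \<Rightarrow> (nat \<Rightarrow> 'a \<Rightarrow> 'a) \<Rightarrow> 'a set \<Rightarrow> 'a set" where
  "hutchinson m f A = (\<Union>i\<in>{1..m}. f i ` A)"

definition H_invariant :: "nat \<Rightarrow> (nat \<Rightarrow> 'a \<Rightarrow> 'a) \<Rightarrow> 'a set \<Rightarrow> bool" where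
  "H_invariant m f A \<longleftrightarrow> hutchinson m f A = A"

definition orbit_relation :: "nat \<Rightarrow> (nat \<Rightarrow> 'a \<Rightarrow> 'a) \<Rightarrow> ('a \<times> 'a) set" where
  "orbit_relation m f = {(x, ifs_word_map f I x) | x I. I \<in> ifs_words m}"

text \<open>
  The case \<open>A = {}\<close> is excluded because the library sets \<open>infdist x {} = 0\<close>, whereas the
  distance to the empty set should be infinite, so that its neighbourhoods are empty.
\<close>

definition set_nbhd :: "real \<Rightarrow> 'a::metric_space set \<Rightarrow> 'a set" where
  "set_nbhd \<epsilon> A = {x. A \<noteq> {} \<and> infdist x A < \<epsilon>}"

definition attracts ::
  "nat \<Rightarrow> (nat \<Rightarrow> 'a::metric_space \<Rightarrow> 'a) \<Rightarrow> 'a set \<Rightarrow> 'a set \<Rightarrow> bool" where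
  "attracts m f A K \<longleftrightarrow>
     (\<forall>\<epsilon>>0. \<exists>\<tau>>0. \<forall>I\<in>ifs_words m. length I \<ge> \<tau> \<longrightarrow> ifs_word_map f I ` K \<subseteq> set_nbhd \<epsilon> A)"

definition global_attractor ::
  "nat \<Rightarrow> (nat \<Rightarrow> 'a::metric_space \<Rightarrow> 'a) \<Rightarrow> 'a set \<Rightarrow> bool" where
  "global_attractor m f A \<longleftrightarrow>
     compact A \<and> H_invariant m f A \<and> (\<forall>K. compact K \<longrightarrow> attracts m f A K)"

definition compact_dynamics :: "nat \<Rightarrow> (nat \<Rightarrow> 'a::metric_space \<Rightarrow> 'a) \<Rightarrow> bool" where
  "compact_dynamics m f \<longleftrightarrow> (\<exists>A. global_attractor m f A)"

definition is_stream ::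
  "nat \<Rightarrow> (nat \<Rightarrow> 'a::metric_space \<Rightarrow> 'a) \<Rightarrow> ('a \<times> 'a) set \<Rightarrow> bool" where
  "is_stream m f S \<longleftrightarrow> refl S \<and> trans S \<and> closed S \<and> orbit_relation m f \<subseteq> S"

definition smallest_stream ::
  "nat \<Rightarrow> (nat \<Rightarrow> 'a::metric_space \<Rightarrow> 'a) \<Rightarrow> ('a \<times> 'a) set" where
  "smallest_stream m f = \<Inter>{S. is_stream m f S}"

lemma is_stream_smallest_stream: "is_stream m f (smallest_stream m f)"
  unfolding is_stream_def smallest_stream_def
  by (intro conjI reflI transI closed_Inter) (auto dest: reflD transD)

definition stream_equiv :: "('a \<times> 'a) set \<Rightarrow> ('a \<times> 'a) set" where
  "stream_equiv S = {(x, y). (x, y) \<in> S \<and> (y, x) \<in> S}"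

definition stream_recurrent ::
  "nat \<Rightarrow> (nat \<Rightarrow> 'a \<Rightarrow> 'a) \<Rightarrow> ('a \<times> 'a) set \<Rightarrow> 'a set" where
  "stream_recurrent m f S = {x. \<exists>i\<in>{1..m}. (x, f i x) \<in> stream_equiv S}"

text \<open>The equivalence is restricted to the recurrent points before the quotient is formed.\<close>

definition stream_nodes ::
  "nat \<Rightarrow> (nat \<Rightarrow> 'a \<Rightarrow> 'a) \<Rightarrow> ('a \<times> 'a) set \<Rightarrow> 'a set set" where
  "stream_nodes m f S =
     stream_recurrent m f S //
       (stream_equiv S \<inter> stream_recurrent m f S \<times> stream_recurrent m f S)"

definition eps_chain ::
  "nat \<Rightarrow> (nat \<Rightarrow> 'a::metric_space \<Rightarrow> 'a) \<Rightarrow> real \<Rightarrow> 'a \<Rightarrow> 'a \<Rightarrow> bool" where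
  "eps_chain m f \<epsilon> x y \<longleftrightarrow>
     (\<exists>(k::nat) (c :: nat \<Rightarrow> 'a) (ix :: nat \<Rightarrow> nat). c 0 = x \<and> c k = y \<and>
        (\<forall>n<k. ix n \<in> {1..m} \<and> dist (f (ix n) (c n)) (c (Suc n)) < \<epsilon>))"

definition chain_stream ::
  "nat \<Rightarrow> (nat \<Rightarrow> 'a::metric_space \<Rightarrow> 'a) \<Rightarrow> ('a \<times> 'a) set" where
  "chain_stream m f = {(x, y). \<forall>\<epsilon>>0. eps_chain m f \<epsilon> x y}"

end

theory Submission
  imports Defs
begin

text \<open>
  The chain stream is a stream, so only \<open>\<C> \<subseteq> \<A>\<close> needs an argument. Suppose \<open>(x, y) \<in> \<C> - \<A>\<close>.
  By compact dynamics, \<open>x\<close> lies in a compact set \<open>Q\<close> that every map sends into the interior of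
  \<open>Q\<close>; fine chains from \<open>x\<close> cannot leave it, so \<open>y \<in> Q\<close>. The closed preorder \<open>\<A>\<close> on the compact
  metric space \<open>Q\<close> has a continuous Lyapunov function \<open>L\<close> with \<open>L x < L y\<close> that strictly decreases
  along \<open>\<A>\<close> except between equivalent points. It is constant on nodes, so some \<open>c\<close> between
  \<open>L x\<close> and \<open>L y\<close> is not its value at a recurrent point. Then every map sends \<open>{L \<le> c}\<close> into
  the interior of \<open>{L \<le> c}\<close>, so fine chains from \<open>x\<close> cannot reach \<open>y\<close>.
\<close>

section \<open>Continuous monotone functions on compact preordered spaces\<close>

text \<open>The bound \<open>0 \<le> a\<close> is needed since \<open>dyadics\<close> consists of
  natural numbers divided by powers of two, hence has no negative elements.\<close>

lemma dyadic_between: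
  fixes a b :: real
  assumes "0 \<le> a" "a < b"
  obtains r where "r \<in> dyadics" "a < r" "r < b"
proof -
  have "closure ({a<..<b} \<inter> dyadics) = closure {a<..<b}"
    unfolding dyadics_def
    by (rule closure_dyadic_rationals_in_convex_set_pos_1)
      (use assms in \<open>auto simp: interior_open\<close>)
  then have "{a<..<b} \<inter> dyadics \<noteq> {}"
    using assms(2) by fastforce
  then show ?thesis using that by auto
qed

text \<open>\<open>S\<close> lives on the whole space and only \<open>Q\<close> is compact, so a
  stream can be inserted without restricting it to \<open>Q\<close>.\<close>

locale compact_preorder =
  fixes Q :: "'a::metric_space set" and S :: "('a \<times> 'a) set"
  assumes compact_Q: "compact Q" and closed_S: "closed S" and refl_S: "refl S" and trans_S: "trans S"
begin

text \<open>Reading \<open>(u, v) \<in> S\<close> as "u is below v", these are the closed up-sets of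
  \<open>Q\<close>. They play the part of the sublevel sets of functions that decrease along
  \<open>S\<close>.\<close>

definition upper :: "'a set \<Rightarrow> bool" where
  "upper F \<longleftrightarrow> compact F \<and> F \<subseteq> Q \<and> (\<forall>u\<in>F. \<forall>v\<in>Q. (u, v) \<in> S \<longrightarrow> v \<in> F)"

text \<open>\<open>F\<close> lies in the interior of \<open>G\<close> relative to \<open>Q\<close>.\<close>
definition well_inside :: "'a set \<Rightarrow> 'a set \<Rightarrow> bool" where
  "well_inside F G \<longleftrightarrow> upper F \<and> upper G \<and> F \<inter> closure (Q - G) = {}"

text \<open>Strictness is left to \<open>complete_lyapunov\<close>; the common range makes weighted
  series of such functions converge uniformly.\<close>

definition lyapunov :: "('a \<Rightarrow> real) \<Rightarrow> bool" where
  "lyapunov L \<longleftrightarrow> continuous_on Q L \<and> L ` Q \<subseteq> {0..1} \<and>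
     (\<forall>u\<in>Q. \<forall>v\<in>Q. (u, v) \<in> S \<longrightarrow> L v \<le> L u)"

lemma closed_Q: "closed Q"
  using compact_Q compact_imp_closed by blast

lemma well_inside_subset: "well_inside F G \<Longrightarrow> F \<subseteq> G"
  unfolding well_inside_def upper_def using closure_subset by fast

lemma well_inside_trans:
  assumes "well_inside F G" "well_inside G H"
  shows "well_inside F H"
proof -
  have "closure (Q - H) \<subseteq> closure (Q - G)"
    by (intro closure_mono) (use well_inside_subset[OF assms(2)] in auto)
  then show ?thesis using assms unfolding well_inside_def by blast
qed

lemma compact_image:
  assumes "compact C" shows "compact {v \<in> Q. \<exists>u\<in>C. (u, v) \<in> S}"
proof -
  have "compact (snd ` (S \<inter> C \<times> Q))"
    by (intro compact_continuous_image continuous_intros closed_Int_compact closed_S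
        compact_Times assms compact_Q)
  moreover have "snd ` (S \<inter> C \<times> Q) = {v \<in> Q. \<exists>u\<in>C. (u, v) \<in> S}"
    by force
  ultimately show ?thesis by simp
qed

lemma compact_preimage:
  assumes "compact C" shows "compact {u \<in> Q. \<exists>v\<in>C. (u, v) \<in> S}"
proof -
  have "compact (fst ` (S \<inter> Q \<times> C))"
    by (intro compact_continuous_image continuous_intros closed_Int_compact closed_S
        compact_Times assms compact_Q)
  moreover have "fst ` (S \<inter> Q \<times> C) = {u \<in> Q. \<exists>v\<in>C. (u, v) \<in> S}"
    by force
  ultimately show ?thesis by simp
qed

text \<open>Normality of the ordered space. The predecessors \<open>B'\<close> of \<open>B\<close>
  miss \<open>F\<close>, as \<open>F\<close> is closed under successors. Separate \<open>F\<close>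
  and \<open>B'\<close> by open sets \<open>U\<close> and \<open>V\<close>, and let \<open>M\<close>
  consist of the successors of \<open>Q - V\<close>. By reflexivity \<open>Q - M\<close> lies in
  \<open>V\<close>, so its closure avoids \<open>U\<close>. A point of \<open>M\<close> in
  \<open>B'\<close> would put its predecessor outside \<open>V\<close> into \<open>B'\<close>, by
  transitivity.\<close>

lemma upper_separation:
  assumes F: "upper F" and B: "compact B" "B \<subseteq> Q" and disj: "F \<inter> B = {}"
  shows "\<exists>M. well_inside F M \<and> M \<inter> B = {}"
proof -
  define B' where "B' = {u \<in> Q. \<exists>v\<in>B. (u, v) \<in> S}"
  have "B \<subseteq> B'"
    using B refl_S unfolding B'_def by (auto dest: reflD)
  have "F \<inter> B' = {}"
    using F disj B unfolding upper_def B'_def by blast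
  moreover have "closed F" "closed B'"
    using F compact_preimage[OF B(1)] unfolding upper_def B'_def by (auto intro: compact_imp_closed)
  ultimately obtain U V where UV: "open U" "open V" "F \<subseteq> U" "B' \<subseteq> V" "U \<inter> V = {}"
    using t4_space by metis
  define M where "M = {v \<in> Q. \<exists>u\<in>Q - V. (u, v) \<in> S}"
  have "compact (Q - V)"
    using compact_Q UV by (simp add: compact_diff)
  then have "upper M"
    unfolding upper_def M_def using compact_image trans_S by (auto dest: transD)
  have "Q - M \<subseteq> - U"
    unfolding M_def using refl_S UV by (auto dest: reflD)
  then have "closure (Q - M) \<subseteq> - U"
    using UV by (intro closure_minimal) auto
  then have "well_inside F M"
    unfolding well_inside_def using F \<open>upper M\<close> UV by blast
  moreover have "M \<inter> B' = {}"
  proof -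
    have False if "v \<in> M" "v \<in> B'" for v
    proof -
      obtain u where u: "u \<in> Q" "u \<notin> V" "(u, v) \<in> S" using \<open>v \<in> M\<close> M_def by auto
      obtain w where w: "w \<in> B" "(v, w) \<in> S" using \<open>v \<in> B'\<close> B'_def by auto
      have "u \<in> B'" using u w trans_S unfolding B'_def by (auto dest: transD)
      then show False using u UV by auto
    qed
    then show ?thesis by auto
  qed
  ultimately show ?thesis using \<open>B \<subseteq> B'\<close> by blast
qed

text \<open>Separating \<open>F\<close> from the closure of \<open>Q - G\<close>, instead of from
  \<open>Q - G\<close>, is what puts the new set well inside \<open>G\<close>.\<close>

lemma well_inside_interpolate:
  assumes "well_inside F G"
  shows "\<exists>M. well_inside F M \<and> well_inside M G"
proof -
  have cl: "closure (Q - G) \<subseteq> Q"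
    by (intro closure_minimal closed_Q) auto
  have "compact (closure (Q - G))"
    using cl compact_Q by (metis closed_closure compact_Int_closed inf.absorb2)
  then obtain M where "well_inside F M" "M \<inter> closure (Q - G) = {}"
    using upper_separation[of F "closure (Q - G)"] cl assms unfolding well_inside_def by blast
  then show ?thesis using assms unfolding well_inside_def by blast
qed

text \<open>Nachbin's ordered version of Urysohn's lemma.\<close>
lemma lyapunov_separation:
  assumes a: "a \<in> Q" and b: "b \<in> Q" and ab: "(a, b) \<notin> S"
  shows "\<exists>L. lyapunov L \<and> L a = 0 \<and> L b = 1"
proof -
  define F where "F = {v \<in> Q. \<exists>u\<in>{a}. (u, v) \<in> S}"
  have "compact F" unfolding F_def by (rule compact_image) simp
  then have "upper F"
    unfolding upper_def F_def using trans_S by (auto dest: transD)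
  have "a \<in> F" unfolding F_def using a refl_S by (auto dest: reflD)
  have "b \<notin> F" using ab F_def by auto
  obtain M where M: "well_inside F M" "b \<notin> M"
    using upper_separation[OF \<open>upper F\<close>, of "{b}"] b \<open>b \<notin> F\<close> by auto
  define D :: "real set" where "D = dyadics \<inter> {0..1}"
  \<comment> \<open>The Urysohn scale: dyadic recursion needs only that \<open>well_inside\<close>
    is transitive and can be interpolated.\<close>
  have "\<exists>G :: real \<Rightarrow> 'a set. G 0 = F \<and> G 1 = M \<and>
     (\<forall>x \<in> dyadics \<inter> {0..1}. \<forall>y \<in> dyadics \<inter> {0..1}. x < y \<longrightarrow> well_inside (G x) (G y))"
    using M(1) well_inside_interpolate well_inside_trans
    by (rule recursion_on_dyadic_fractions[where R = well_inside])
  then obtain G where G0: "G 0 = F" and G1: "G 1 = M" and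
    G: "\<And>r s. r \<in> D \<Longrightarrow> s \<in> D \<Longrightarrow> r < s \<Longrightarrow> well_inside (G r) (G s)"
    unfolding D_def by blast
  have D0: "0 \<in> D" and D1: "1 \<in> D"
    unfolding D_def using real_in_dyadics[of 0] real_in_dyadics[of 1] by auto
  have D_ge: "0 \<le> r" and D_le: "r \<le> 1" if "r \<in> D" for r
    using that by (auto simp: D_def)
  have upG: "upper (G r)" if "r \<in> D" for r
  proof (cases "r < 1")
    case True
    then show ?thesis using G[OF that D1] well_inside_def by blast
  next
    case False
    then have "r = 1" using D_le[OF that] by auto
    then show ?thesis using G1 M well_inside_def by blast
  qed
  have monoG: "G r \<subseteq> G s" if "r \<in> D" "s \<in> D" "r \<le> s" for r s
    using that G well_inside_subset by (cases "r = s") auto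
  \<comment> \<open>Inserting 1 keeps the set nonempty and gives the value 1 to points that lie in
    no \<open>G r\<close>.\<close>
  define L where "L = (\<lambda>x. Inf (insert 1 {r \<in> D. x \<in> G r}))"
  have bdd: "bdd_below (insert 1 {r \<in> D. x \<in> G r})" for x
    by (rule bdd_belowI[of _ 0]) (auto simp: D_ge)
  have L_le1: "L x \<le> 1" for x
    unfolding L_def by (intro cInf_lower bdd) simp
  have L_le: "L x \<le> r" if "r \<in> D" "x \<in> G r" for x r
    unfolding L_def by (intro cInf_lower bdd) (use that in simp)
  have L_ge: "t \<le> L x" if "t \<le> 1" "\<And>r. r \<in> D \<Longrightarrow> x \<in> G r \<Longrightarrow> t \<le> r" for t x
    unfolding L_def by (rule cInf_greatest) (use that in auto)
  have L_ge0: "0 \<le> L x" for x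
    by (rule L_ge) (auto simp: D_ge)
  have L_ge': "s \<le> L x" if "s \<in> D" "x \<notin> G s" for s x
  proof (rule L_ge)
    show "s \<le> 1" using D_le[OF that(1)] .
    show "s \<le> r" if "r \<in> D" "x \<in> G r" for r
      using monoG[of r s] that \<open>s \<in> D\<close> \<open>x \<notin> G s\<close> by (cases "r \<le> s") auto
  qed
  have mono: "L v \<le> L u" if "u \<in> Q" "v \<in> Q" "(u, v) \<in> S" for u v
  proof (rule L_ge[OF L_le1])
    fix r assume r: "r \<in> D" "u \<in> G r"
    then have "v \<in> G r" using upG that unfolding upper_def by blast
    then show "L v \<le> r" using L_le r by blast
  qed
  \<comment> \<open>Lower bounds persist near \<open>z\<close> because each \<open>G s\<close> is
    closed; upper bounds persist because, for \<open>r < s\<close>, points of \<open>G r\<close> are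
    interior to \<open>G s\<close> relative to \<open>Q\<close>. The cases \<open>c < 0\<close> and
    \<open>1 < c\<close> fall outside the range of the scale.\<close>
  have lim: "(L \<longlongrightarrow> L z) (at z within Q)" if z: "z \<in> Q" for z
  proof (rule order_tendstoI)
    fix c assume c: "c < L z"
    show "\<forall>\<^sub>F x in at z within Q. c < L x"
    proof (cases "c < 0")
      case True
      then have "c < L x" for x using L_ge0[of x] by simp
      then show ?thesis by simp
    next
      case False
      then obtain s where s: "s \<in> dyadics" "c < s" "s < L z"
        using dyadic_between[of c "L z"] c by auto
      then have sD: "s \<in> D" using False L_le1[of z] by (auto simp: D_def)
      then have "z \<notin> G s" using L_le s by force
      moreover have "closed (G s)"
        using upG[OF sD] upper_def compact_imp_closed by blast
      ultimately have "\<forall>\<^sub>F x in at z within Q. x \<in> - G s"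
        by (intro topological_tendstoD[OF tendsto_ident_at]) auto
      then show ?thesis
        by eventually_elim (use L_ge'[OF sD] s in force)
    qed
  next
    fix c assume c: "L z < c"
    show "\<forall>\<^sub>F x in at z within Q. L x < c"
    proof (cases "1 < c")
      case True
      then have "L x < c" for x using L_le1[of x] by simp
      then show ?thesis by simp
    next
      case False
      obtain r where r: "r \<in> insert 1 {r \<in> D. z \<in> G r}" "r < c"
        using c cInf_lessD[of "insert 1 {r \<in> D. z \<in> G r}" c] unfolding L_def by blast
      then have r': "r \<in> D" "z \<in> G r" using False by auto
      then obtain s where s: "s \<in> dyadics" "r < s" "s < c"
        using dyadic_between[of r c] r D_ge by auto
      then have sD: "s \<in> D" using False D_ge[OF r'(1)] by (auto simp: D_def)
      have "z \<notin> closure (Q - G s)"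
        using G[OF r'(1) sD s(2)] r'(2) unfolding well_inside_def by blast
      then have "\<forall>\<^sub>F x in at z within Q. x \<in> - closure (Q - G s)"
        by (intro topological_tendstoD[OF tendsto_ident_at]) auto
      moreover have "\<forall>\<^sub>F x in at z within Q. x \<in> Q"
        by (simp add: eventually_at_filter)
      ultimately show ?thesis
      proof eventually_elim
        case (elim x)
        then have "x \<in> G s" using closure_subset[of "Q - G s"] by auto
        then show ?case using L_le[OF sD] s by force
      qed
    qed
  qed
  have "L a = 0"
    using L_le[OF D0] L_ge0[of a] G0 \<open>a \<in> F\<close> by force
  moreover have "L b = 1"
    using L_ge'[OF D1] L_le1[of b] G1 M by force
  moreover have "lyapunov L"
    unfolding lyapunov_def continuous_on_def using lim mono L_ge0 L_le1 by auto
  ultimately show ?thesis by blast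
qed

text \<open>The complement of \<open>S\<close> in \<open>Q \<times> Q\<close> is \<open>\<sigma>\<close>-compact.\<close>
lemma countable_lyapunov_family:
  obtains \<L> where "countable \<L>" "\<And>L. L \<in> \<L> \<Longrightarrow> lyapunov L"
    "\<And>u v. u \<in> Q \<Longrightarrow> v \<in> Q \<Longrightarrow> (u, v) \<notin> S \<Longrightarrow> \<exists>L\<in>\<L>. L u < L v"
proof -
  define P where "P n = Q \<times> Q \<inter> {p. 1 / real (Suc n) \<le> infdist p S}" for n
  have Sne: "S \<noteq> {}" using refl_S by (auto simp: refl_on_def)
  have "\<exists>\<F>. finite \<F> \<and> (\<forall>L\<in>\<F>. lyapunov L) \<and> (\<forall>u v. (u, v) \<in> P n \<longrightarrow> (\<exists>L\<in>\<F>. L u < L v))"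
    for n
  proof -
    have "closed {p. 1 / real (Suc n) \<le> infdist p S}"
      by (intro closed_Collect_le continuous_intros)
    then have cP: "compact (P n)"
      unfolding P_def by (intro compact_Int_closed compact_Times compact_Q)
    \<comment> \<open>The pairs for which \<open>L\<close> witnesses non-membership in
      \<open>S\<close>. These sets are relatively open, so finitely many \<open>L\<close> suffice
      for the compact set \<open>P n\<close>.\<close>
    define U where "U L = Q \<times> Q \<inter> {p. L (fst p) < L (snd p)}" for L :: "'a \<Rightarrow> real"
    have "openin (top_of_set (Q \<times> Q)) (U L)" if "lyapunov L" for L
    proof -
      have "continuous_on Q L" using that lyapunov_def by blast
      then have "continuous_on (Q \<times> Q) (\<lambda>p. L (snd p))" "continuous_on (Q \<times> Q) (\<lambda>p. L (fst p))"
        by (auto intro!: continuous_on_compose2[of Q L] continuous_on_snd continuous_on_fst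
            continuous_on_id)
      then have "continuous_on (Q \<times> Q) (\<lambda>p. L (snd p) - L (fst p))"
        by (rule continuous_on_diff)
      then have "openin (top_of_set (Q \<times> Q)) (Q \<times> Q \<inter> (\<lambda>p. L (snd p) - L (fst p)) -` {0<..})"
        by (rule continuous_openin_preimage_gen) simp
      moreover have "Q \<times> Q \<inter> (\<lambda>p. L (snd p) - L (fst p)) -` {0<..} = U L"
        unfolding U_def by auto
      ultimately show ?thesis by simp
    qed
    then obtain V where V: "\<And>L. lyapunov L \<Longrightarrow> open (V L) \<and> U L = Q \<times> Q \<inter> V L"
      unfolding openin_open by metis
    have "P n \<subseteq> (\<Union>L\<in>Collect lyapunov. V L)"
    proof
      fix p assume p: "p \<in> P n"
      obtain u v where uv: "p = (u, v)" by fastforce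
      have "infdist p S > 0" using p unfolding P_def
        by (smt (verit) IntE divide_pos_pos mem_Collect_eq of_nat_0_less_iff zero_less_Suc)
      then have "(u, v) \<notin> S" using uv infdist_zero by fastforce
      moreover have "u \<in> Q" "v \<in> Q" using p uv P_def by auto
      ultimately obtain L where "lyapunov L" "L u = 0" "L v = 1"
        using lyapunov_separation by blast
      then have "p \<in> U L" using uv \<open>u \<in> Q\<close> \<open>v \<in> Q\<close> U_def by auto
      then show "p \<in> (\<Union>L\<in>Collect lyapunov. V L)"
        using V[OF \<open>lyapunov L\<close>] \<open>lyapunov L\<close> by blast
    qed
    then obtain \<F> where \<F>: "\<F> \<subseteq> Collect lyapunov" "finite \<F>" "P n \<subseteq> (\<Union>L\<in>\<F>. V L)"
      using compactE_image[OF cP, of "Collect lyapunov" V] V by blast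
    have "\<exists>L\<in>\<F>. L u < L v" if uv: "(u, v) \<in> P n" for u v
    proof -
      obtain L where L: "L \<in> \<F>" "(u, v) \<in> V L" using \<F>(3) uv by blast
      then have "(u, v) \<in> U L" using V[of L] \<F>(1) uv unfolding P_def by blast
      then show ?thesis using L U_def by auto
    qed
    then show ?thesis using \<F> by blast
  qed
  then obtain \<F> where \<F>: "\<And>n. finite (\<F> n)" "\<And>n L. L \<in> \<F> n \<Longrightarrow> lyapunov L"
    "\<And>n u v. (u, v) \<in> P n \<Longrightarrow> \<exists>L\<in>\<F> n. L u < L v"
    by metis
  show ?thesis
  proof (rule that[of "\<Union>n. \<F> n"])
    show "countable (\<Union>n. \<F> n)" using \<F>(1) by (auto intro: countable_finite)
    show "lyapunov L" if "L \<in> (\<Union>n. \<F> n)" for L using that \<F>(2) by blast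
    show "\<exists>L\<in>\<Union>n. \<F> n. L u < L v" if uv: "u \<in> Q" "v \<in> Q" "(u, v) \<notin> S" for u v
    proof -
      have "infdist (u, v) S > 0"
        using uv(3) closed_S Sne by (simp add: infdist_pos_not_in_closed)
      then obtain n where "1 / real (Suc n) < infdist (u, v) S"
        using reals_Archimedean by (auto simp: inverse_eq_divide)
      then have "(u, v) \<in> P n"
        unfolding P_def using uv(1,2) by (simp del: of_nat_Suc)
      from \<F>(3)[OF this] show ?thesis by blast
    qed
  qed
qed

text \<open>A series over the countable family with weights \<open>(1/2) ^ Suc n\<close> decreases
  strictly between inequivalent related points; adding a multiple of one function that separates
  \<open>x\<close> from \<open>y\<close> secures \<open>L x < L y\<close>.\<close>

lemma complete_lyapunov:
  assumes x: "x \<in> Q" and y: "y \<in> Q" and xy: "(x, y) \<notin> S"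
  shows "\<exists>L :: 'a \<Rightarrow> real. continuous_on Q L \<and>
    (\<forall>u\<in>Q. \<forall>v\<in>Q. (u, v) \<in> S \<longrightarrow> L v \<le> L u \<and> (L u = L v \<longrightarrow> (v, u) \<in> S)) \<and> L x < L y"
proof -
  obtain L0 where L0: "lyapunov L0" "L0 x = 0" "L0 y = 1"
    using lyapunov_separation[OF assms] by blast
  obtain \<L> where \<L>: "countable \<L>" "\<And>L. L \<in> \<L> \<Longrightarrow> lyapunov L"
    "\<And>u v. u \<in> Q \<Longrightarrow> v \<in> Q \<Longrightarrow> (u, v) \<notin> S \<Longrightarrow> \<exists>L\<in>\<L>. L u < L v"
    using countable_lyapunov_family by metis
  have "\<L> \<noteq> {}" using \<L>(3)[OF x y xy] by blast
  \<comment> \<open>An enumeration of the nonempty family, possibly with repetitions.\<close>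
  define l where "l = from_nat_into \<L>"
  have l: "lyapunov (l n)" for n
    unfolding l_def using \<L>(2) from_nat_into[OF \<open>\<L> \<noteq> {}\<close>] by blast
  have l01: "0 \<le> l n z" "l n z \<le> 1" if "z \<in> Q" for n z
    using l[of n] that unfolding lyapunov_def by auto
  define g where "g n z = (1/2) ^ Suc n * l n z" for n z
  have half: "(\<lambda>n. (1/2) ^ Suc n) sums (1::real)" by (rule power_half_series)
  have gnorm: "norm (g n z) \<le> (1/2) ^ Suc n" and g0: "0 \<le> g n z" if "z \<in> Q" for n z
    using l01[OF that, of n] unfolding g_def by (auto simp: mult_le_cancel_left1 abs_mult)
  have gsum: "summable (\<lambda>n. g n z)" if "z \<in> Q" for z
    by (rule summable_comparison_test'[where N = 0 and g = "\<lambda>n. (1/2) ^ Suc n"])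
      (use half gnorm[OF that] in \<open>auto simp: sums_iff\<close>)
  have g_mono: "g n v \<le> g n u" if "u \<in> Q" "v \<in> Q" "(u, v) \<in> S" for u v n
    using l[of n] that unfolding g_def lyapunov_def by (auto intro!: mult_left_mono)
  define \<Lambda> where "\<Lambda> z = (\<Sum>n. g n z)" for z
  have \<Lambda>0: "0 \<le> \<Lambda> z" if "z \<in> Q" for z
    unfolding \<Lambda>_def by (intro suminf_nonneg gsum g0 that)
  have \<Lambda>1: "\<Lambda> z \<le> 1" if "z \<in> Q" for z
  proof -
    have "\<Lambda> z \<le> (\<Sum>n. (1/2) ^ Suc n)"
      unfolding \<Lambda>_def
    proof (rule suminf_le)
      show "g n z \<le> (1/2) ^ Suc n" for n using gnorm[OF that, of n] by simp
    qed (use gsum[OF that] sums_summable[OF half] in auto)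
    then show ?thesis using sums_unique[OF half] by simp
  qed
  have \<Lambda>_mono: "\<Lambda> v \<le> \<Lambda> u" if "u \<in> Q" "v \<in> Q" "(u, v) \<in> S" for u v
    unfolding \<Lambda>_def by (intro suminf_le gsum g_mono that)
  have \<Lambda>_cont: "continuous_on Q \<Lambda>"
  proof (rule uniform_limit_theorem)
    show "uniform_limit Q (\<lambda>n z. \<Sum>i<n. g i z) \<Lambda> sequentially"
      unfolding \<Lambda>_def by (rule Weierstrass_m_test[where M = "\<lambda>n. (1/2) ^ Suc n"])
        (use gnorm half in \<open>auto simp: sums_iff\<close>)
    have "continuous_on Q (g i)" for i
      unfolding g_def using l[of i] by (intro continuous_intros) (simp add: lyapunov_def)
    then show "\<forall>\<^sub>F n in sequentially. continuous_on Q (\<lambda>z. \<Sum>i<n. g i z)"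
      by (intro always_eventually allI continuous_intros)
  qed simp
  \<comment> \<open>If \<open>(v, u)\<close> were not in \<open>S\<close>, some member of the family
    would satisfy \<open>L v < L u\<close>. Its term decreases strictly from \<open>u\<close> to
    \<open>v\<close> and no term increases, so the sums differ.\<close>
  have \<Lambda>_strict: "(v, u) \<in> S" if uv: "u \<in> Q" "v \<in> Q" "(u, v) \<in> S" and eq: "\<Lambda> u = \<Lambda> v" for u v
  proof (rule ccontr)
    assume "(v, u) \<notin> S"
    then obtain L where L: "L \<in> \<L>" "L v < L u" using \<L>(3) uv by blast
    then obtain k where "l k = L"
      unfolding l_def using \<L>(1) from_nat_into_surj by metis
    then have "g k v < g k u" 
      unfolding g_def using L \<open>l k = L\<close> by (intro mult_strict_left_mono) auto
    then have "0 < (\<Sum>n. g n u - g n v)"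
      by (intro suminf_pos2[where i = k] summable_diff gsum uv)
        (use g_mono[OF uv] in auto)
    also have "\<dots> = \<Lambda> u - \<Lambda> v"
      unfolding \<Lambda>_def by (rule suminf_diff[symmetric]) (intro gsum uv)+
    finally show False using eq by simp
  qed
  show ?thesis
  \<comment> \<open>The factor 2 beats the oscillation of \<open>\<Lambda>\<close>, which has values
    in [0, 1]: the sum is at most 1 at \<open>x\<close> and at least 2 at \<open>y\<close>.\<close>
  proof (intro exI[of _ "\<lambda>z. 2 * L0 z + \<Lambda> z"] conjI ballI impI)
    show "continuous_on Q (\<lambda>z. 2 * L0 z + \<Lambda> z)"
      using L0(1) \<Lambda>_cont by (intro continuous_intros) (auto simp: lyapunov_def)
    have L0_mono: "L0 v \<le> L0 u" if "u \<in> Q" "v \<in> Q" "(u, v) \<in> S" for u v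
      using L0(1) that unfolding lyapunov_def by blast
    show "2 * L0 v + \<Lambda> v \<le> 2 * L0 u + \<Lambda> u" if "u \<in> Q" "v \<in> Q" "(u, v) \<in> S" for u v
      using L0_mono[OF that] \<Lambda>_mono[OF that] by simp
    show "(v, u) \<in> S" if "u \<in> Q" "v \<in> Q" "(u, v) \<in> S" "2 * L0 u + \<Lambda> u = 2 * L0 v + \<Lambda> v" for u v
      using \<Lambda>_strict[OF that(1-3)] L0_mono[OF that(1-3)] \<Lambda>_mono[OF that(1-3)] that(4) by force
    show "2 * L0 x + \<Lambda> x < 2 * L0 y + \<Lambda> y"
      using L0 \<Lambda>0[OF y] \<Lambda>1[OF x] by simp
  qed
qed

end

section \<open>The chain stream\<close>

text \<open>Makes concatenation and induction of chains available from the theory of closures;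
  \<open>k = 0\<close> corresponds to reflexivity.\<close>

lemma eps_chain_iff_rtranclp:
  "eps_chain m f \<epsilon> = (\<lambda>u v. \<exists>i\<in>{1..m}. dist (f i u) v < \<epsilon>)\<^sup>*\<^sup>*" (is "_ = ?R\<^sup>*\<^sup>*")
proof (intro ext iffI)
  fix x y
  assume "eps_chain m f \<epsilon> x y"
  then obtain k c ix where c: "c 0 = x" "c k = y"
    "\<forall>n<k. ix n \<in> {1..m} \<and> dist (f (ix n) (c n)) (c (Suc n)) < \<epsilon>"
    unfolding eps_chain_def by blast
  have "n \<le> k \<Longrightarrow> ?R\<^sup>*\<^sup>* x (c n)" for n
  proof (induction n)
    case (Suc n)
    then have "?R\<^sup>*\<^sup>* x (c n)" by simp
    moreover have "?R (c n) (c (Suc n))" using c(3) Suc.prems by (meson Suc_le_lessD)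
    ultimately show ?case by (rule rtranclp.rtrancl_into_rtrancl)
  qed (simp add: c)
  then show "?R\<^sup>*\<^sup>* x y" using c by blast
next
  fix x y
  assume "?R\<^sup>*\<^sup>* x y"
  then show "eps_chain m f \<epsilon> x y"
  proof (induction rule: rtranclp_induct)
    case base
    show ?case unfolding eps_chain_def by (rule exI[of _ 0]) auto
  next
    case (step y z)
    then obtain k c ix where c: "c 0 = x" "c k = y"
      "\<forall>n<k. ix n \<in> {1..m} \<and> dist (f (ix n) (c n)) (c (Suc n)) < \<epsilon>"
      unfolding eps_chain_def by blast
    obtain i where i: "i \<in> {1..m}" "dist (f i y) z < \<epsilon>" using step by blast
    show ?case unfolding eps_chain_def
      by (rule exI[of _ "Suc k"], rule exI[of _ "c(Suc k := z)"], rule exI[of _ "ix(k := i)"])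
        (use c i in \<open>auto simp: less_Suc_eq\<close>)
  qed
qed

text \<open>The images of \<open>K\<close> form a compact subset of the open set
  \<open>interior K\<close>, so some \<open>\<epsilon>\<close>-neighbourhood of them stays in it. No
  \<open>\<epsilon>\<close>-chain that starts in \<open>K\<close> can then leave
  \<open>K\<close>.\<close>

lemma chain_stream_trapped:
  fixes f :: "nat \<Rightarrow> 'a::metric_space \<Rightarrow> 'a"
  assumes "is_ifs m f" and K: "compact K" and inv: "\<And>i. i \<in> {1..m} \<Longrightarrow> f i ` K \<subseteq> interior K"
    and x: "x \<in> K" and xy: "(x, y) \<in> chain_stream m f"
  shows "y \<in> K"
proof -
  define H where "H = (\<Union>i\<in>{1..m}. f i ` K)"
  have "continuous_on K (f i)" if "i \<in> {1..m}" for i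
    using assms(1) that unfolding is_ifs_def by (meson continuous_on_subset subset_UNIV)
  then have "compact H"
    unfolding H_def by (intro compact_UN compact_continuous_image K) auto
  moreover have "H \<subseteq> interior K" using inv H_def by blast
  ultimately obtain \<epsilon> where \<epsilon>: "\<epsilon> > 0" "(\<Union>z\<in>H. ball z \<epsilon>) \<subseteq> interior K"
    using compact_subset_open_imp_ball_epsilon_subset[of H "interior K"] by auto
  have "eps_chain m f \<epsilon> x y" using xy \<epsilon>(1) unfolding chain_stream_def by blast
  then show ?thesis
    unfolding eps_chain_iff_rtranclp
  proof (induction rule: rtranclp_induct)
    case (step u v)
    then obtain i where "i \<in> {1..m}" "dist (f i u) v < \<epsilon>" by blast
    then have "v \<in> (\<Union>z\<in>H. ball z \<epsilon>)" using step.IH unfolding H_def by auto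
    then show ?case using \<epsilon>(2) interior_subset by blast
  qed (rule x)
qed

lemma closed_chain_stream:
  fixes f :: "nat \<Rightarrow> 'a::metric_space \<Rightarrow> 'a"
  assumes "is_ifs m f"
  shows "closed (chain_stream m f)"
  unfolding closed_sequential_limits
proof (intro allI impI, elim conjE)
  fix p :: "nat \<Rightarrow> 'a \<times> 'a" and l
  assume p: "\<forall>n. p n \<in> chain_stream m f" and lim: "p \<longlonglongrightarrow> l"
  obtain x y where l: "l = (x, y)" by fastforce
  have limx: "(\<lambda>n. fst (p n)) \<longlonglongrightarrow> x" and limy: "(\<lambda>n. snd (p n)) \<longlonglongrightarrow> y"
    using tendsto_fst[OF lim] tendsto_snd[OF lim] l by auto
  have "eps_chain m f \<epsilon> x y" if \<epsilon>: "\<epsilon> > 0" for \<epsilon>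
  \<comment> \<open>The endpoints of a chain can be moved only if it has a step. For
    \<open>x \<noteq> y\<close> the nearby pairs eventually have distinct entries too, which rules
    out chains of length zero.\<close>
  proof (cases "x = y")
    case True
    then show ?thesis unfolding eps_chain_iff_rtranclp by simp
  next
    case False
    define R where "R \<delta> = (\<lambda>u v. \<exists>i\<in>{1..m}. dist (f i u) v < \<delta>)" for \<delta>
    have "\<forall>\<^sub>F n in sequentially. fst (p n) \<noteq> snd (p n)"
    proof -
      have "\<forall>\<^sub>F n in sequentially. p n \<in> {q. fst q \<noteq> snd q}"
      proof (rule topological_tendstoD[OF lim])
        show "open {q :: 'a \<times> 'a. fst q \<noteq> snd q}"
          by (intro open_Collect_neq continuous_intros)
      qed (use False l in auto)
      then show ?thesis by simp
    qed
    moreover have "\<forall>\<^sub>F n in sequentially. \<forall>i\<in>{1..m}. dist (f i (fst (p n))) (f i x) < \<epsilon> / 3"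
    proof (rule eventually_ball_finite)
      show "\<forall>i\<in>{1..m}. \<forall>\<^sub>F n in sequentially. dist (f i (fst (p n))) (f i x) < \<epsilon> / 3"
      proof
        fix i assume "i \<in> {1..m}"
        then have "isCont (f i) x"
          using assms unfolding is_ifs_def by (simp add: continuous_on_eq_continuous_at)
        then have "(\<lambda>n. f i (fst (p n))) \<longlonglongrightarrow> f i x"
          using limx isCont_tendsto_compose by blast
        then show "\<forall>\<^sub>F n in sequentially. dist (f i (fst (p n))) (f i x) < \<epsilon> / 3"
          using \<epsilon> by (intro tendstoD) auto
      qed
    qed simp
    moreover have "\<forall>\<^sub>F n in sequentially. dist (snd (p n)) y < \<epsilon> / 3"
      using limy \<epsilon> by (intro tendstoD) auto
    ultimately have "\<forall>\<^sub>F n in sequentially. fst (p n) \<noteq> snd (p n) \<and>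
        (\<forall>i\<in>{1..m}. dist (f i (fst (p n))) (f i x) < \<epsilon> / 3) \<and> dist (snd (p n)) y < \<epsilon> / 3"
      by eventually_elim blast
    then obtain n where n: "fst (p n) \<noteq> snd (p n)"
      "\<And>i. i \<in> {1..m} \<Longrightarrow> dist (f i (fst (p n))) (f i x) < \<epsilon> / 3"
      "dist (snd (p n)) y < \<epsilon> / 3"
      by (metis (mono_tags, lifting) eventually_happens' sequentially_bot)
    define a b where "a = fst (p n)" and "b = snd (p n)"
    have "eps_chain m f (\<epsilon> / 3) a b"
      using p \<epsilon> unfolding chain_stream_def a_def b_def
      by (metis (mono_tags, lifting) case_prod_unfold divide_pos_pos mem_Collect_eq zero_less_numeral)
    then have chain: "(R (\<epsilon> / 3))\<^sup>*\<^sup>* a b"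
      unfolding eps_chain_iff_rtranclp R_def .
    have R_mono: "R (2 * \<epsilon> / 3) u v" if "R (\<epsilon> / 3) u v" for u v
      using that \<epsilon> unfolding R_def by force
    \<comment> \<open>A chain of one step absorbs the displacement of both its ends, hence thirds of \<open>\<epsilon>\<close>.\<close>
    have "(R (2 * \<epsilon> / 3))\<^sup>+\<^sup>+ x b"
    proof -
      have "(R (\<epsilon> / 3))\<^sup>+\<^sup>+ a b"
        using chain n(1) unfolding a_def b_def by (metis rtranclpD)
      then obtain c where c: "R (\<epsilon> / 3) a c" "(R (\<epsilon> / 3))\<^sup>*\<^sup>* c b"
        by (metis tranclpD)
      then obtain i where i: "i \<in> {1..m}" "dist (f i a) c < \<epsilon> / 3" unfolding R_def by blast
      have "dist (f i x) c \<le> dist (f i a) (f i x) + dist (f i a) c"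
        by (metis dist_commute dist_triangle)
      also have "\<dots> < 2 * \<epsilon> / 3" using n(2)[OF i(1)] i(2) unfolding a_def by simp
      finally have "R (2 * \<epsilon> / 3) x c" unfolding R_def using i by blast
      moreover have "(R (2 * \<epsilon> / 3))\<^sup>*\<^sup>* c b"
        using c(2) R_mono by (metis mono_rtranclp)
      ultimately show ?thesis by (rule rtranclp_into_tranclp2)
    qed
    then obtain c where c: "(R (2 * \<epsilon> / 3))\<^sup>*\<^sup>* x c" "R (2 * \<epsilon> / 3) c b"
      by (metis tranclp.cases tranclp_into_rtranclp rtranclp.rtrancl_refl)
    then obtain i where i: "i \<in> {1..m}" "dist (f i c) b < 2 * \<epsilon> / 3" unfolding R_def by blast
    have "dist (f i c) y \<le> dist (f i c) b + dist b y" by (rule dist_triangle)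
    also have "\<dots> < \<epsilon>" using i n(3) b_def by simp
    finally have "R \<epsilon> c y" unfolding R_def using i by blast
    moreover have "(R \<epsilon>)\<^sup>*\<^sup>* x c"
    proof -
      have "R \<epsilon> u v" if "R (2 * \<epsilon> / 3) u v" for u v
        using that \<epsilon> unfolding R_def by force
      then show ?thesis using c(1) by (metis mono_rtranclp)
    qed
    ultimately have "(R \<epsilon>)\<^sup>*\<^sup>* x y" by simp
    then show ?thesis unfolding eps_chain_iff_rtranclp R_def .
  qed
  then show "l \<in> chain_stream m f" unfolding chain_stream_def l by simp
qed

lemma is_stream_chain_stream:
  fixes f :: "nat \<Rightarrow> 'a::metric_space \<Rightarrow> 'a"
  assumes "is_ifs m f"
  shows "is_stream m f (chain_stream m f)"
  unfolding is_stream_def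
proof (intro conjI closed_chain_stream assms)
  show "refl (chain_stream m f)"
    by (auto simp: refl_on_def chain_stream_def eps_chain_iff_rtranclp)
  show "trans (chain_stream m f)"
    by (rule transI) (auto simp: chain_stream_def eps_chain_iff_rtranclp intro: rtranclp_trans)
  \<comment> \<open>An orbit segment is a chain whose jumps are all zero.\<close>
  have "(x, ifs_word_map f I x) \<in> chain_stream m f" if "I \<in> ifs_words m" for x I
    using that
  proof (induction I rule: rev_induct)
    case Nil
    then show ?case by (simp add: ifs_word_map_Nil chain_stream_def eps_chain_iff_rtranclp)
  next
    case (snoc i I)
    then have i: "i \<in> {1..m}" and IH: "(x, ifs_word_map f I x) \<in> chain_stream m f"
      by (auto simp: ifs_words_def)
    show ?case
      unfolding chain_stream_def
    proof (clarsimp)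
      fix \<epsilon> :: real assume "\<epsilon> > 0"
      then have "(\<lambda>u v. \<exists>i\<in>{1..m}. dist (f i u) v < \<epsilon>)\<^sup>*\<^sup>* x (ifs_word_map f I x)"
        using IH unfolding chain_stream_def eps_chain_iff_rtranclp by blast
      moreover have "\<exists>j\<in>{1..m}. dist (f j (ifs_word_map f I x)) (ifs_word_map f (I @ [i]) x) < \<epsilon>"
        using i \<open>\<epsilon> > 0\<close> by (intro bexI[of _ i]) (simp_all add: ifs_word_map_snoc)
      ultimately show "eps_chain m f \<epsilon> x (ifs_word_map f (I @ [i]) x)"
        unfolding eps_chain_iff_rtranclp by (rule rtranclp.rtrancl_into_rtrancl)
    qed
  qed
  then show "orbit_relation m f \<subseteq> chain_stream m f"
    unfolding orbit_relation_def by blast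
qed

section \<open>Trapping regions\<close>

lemma compact_neighbourhood:
  fixes C :: "'a::metric_space set"
  assumes "locally_compact_space (euclidean :: 'a topology)" "compact C"
  obtains V where "compact V" "C \<subseteq> interior V"
proof -
  have "\<forall>K. compactin (euclidean :: 'a topology) K \<longrightarrow> (\<exists>U L. openin euclidean U \<and>
      compactin euclidean L \<and> closedin euclidean L \<and> K \<subseteq> U \<and> U \<subseteq> L)"
    using assms(1) by (subst (asm) locally_compact_space_compact_closed_compact) auto
  then obtain U L where "open U" "compact L" "C \<subseteq> U" "U \<subseteq> L"
    using assms(2) by auto
  then show ?thesis
    using that[of L] interior_maximal[of U L] by blast
qed

text \<open>From any compact neighbourhood of \<open>C\<close>, remove an open neighbourhood of the
  complement of \<open>U\<close> that is disjoint from a neighbourhood of \<open>C\<close>.\<close>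

lemma compact_neighbourhood_within:
  fixes C :: "'a::metric_space set"
  assumes "locally_compact_space (euclidean :: 'a topology)" "compact C" "open U" "C \<subseteq> U"
  obtains V where "compact V" "C \<subseteq> interior V" "V \<subseteq> U"
proof -
  obtain W where W: "compact W" "C \<subseteq> interior W"
    using compact_neighbourhood[OF assms(1,2)] .
  have "closed C" "closed (- U)" "C \<inter> - U = {}"
    using assms compact_imp_closed by auto
  then obtain O1 O2 where O: "open O1" "open O2" "C \<subseteq> O1" "- U \<subseteq> O2" "O1 \<inter> O2 = {}"
    using t4_space by metis
  show ?thesis
  proof (rule that)
    show "compact (W - O2)" using W O by (simp add: compact_diff)
    have "interior W \<inter> O1 \<subseteq> interior (W - O2)"
      using O interior_subset[of W] by (intro interior_maximal) auto
    then show "C \<subseteq> interior (W - O2)" using W O by blast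
    show "W - O2 \<subseteq> U" using O by blast
  qed
qed

lemma ifs_word_map_Cons: "ifs_word_map f (i # I) x = ifs_word_map f I (f i x)"
  by (simp add: ifs_word_map_def)

lemma continuous_on_ifs_word_map:
  assumes "is_ifs m f" "I \<in> ifs_words m"
  shows "continuous_on UNIV (ifs_word_map f I)"
  using assms(2)
proof (induction I rule: rev_induct)
  case Nil
  then show ?case by (simp add: ifs_word_map_Nil continuous_on_id id_def)
next
  case (snoc i I)
  then have "continuous_on UNIV (f i)" "continuous_on UNIV (ifs_word_map f I)"
    using assms(1) by (auto simp: is_ifs_def ifs_words_def)
  then show ?case
    unfolding ifs_word_map_snoc by (meson continuous_on_compose continuous_on_subset subset_UNIV)
qed

text \<open>
  Induction on the word length: a compact neighbourhood of \<open>H(W)\<close> still enters \<open>U\<close> under all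
  shorter words, and the set \<open>Q\<close> obtained for it is enlarged by \<open>W\<close>. Taking \<open>U\<close> to be the
  interior of \<open>W\<close> makes \<open>Q\<close> a trapping region.
\<close>
lemma trapping_region_of_words:
  fixes f :: "nat \<Rightarrow> 'a::metric_space \<Rightarrow> 'a"
  assumes lc: "locally_compact_space (euclidean :: 'a topology)" and ifs: "is_ifs m f"
    and U: "open U"
  shows "compact W \<Longrightarrow> (\<And>I. I \<in> ifs_words m \<Longrightarrow> length I = Suc n \<Longrightarrow> ifs_word_map f I ` W \<subseteq> U) \<Longrightarrow>
     \<exists>Q. compact Q \<and> W \<subseteq> Q \<and> (\<forall>i\<in>{1..m}. f i ` Q \<subseteq> interior Q \<union> U)"
proof (induction n arbitrary: W)
  case 0
  have "f i ` W \<subseteq> U" if "i \<in> {1..m}" for i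
    using 0(2)[of "[i]"] that by (auto simp: ifs_words_def ifs_word_map_def)
  then show ?case using 0(1) by blast
next
  case (Suc n)
  define H where "H = (\<Union>i\<in>{1..m}. f i ` W)"
  have "continuous_on W (f i)" if "i \<in> {1..m}" for i
    using ifs that unfolding is_ifs_def by (meson continuous_on_subset subset_UNIV)
  then have "compact H"
    unfolding H_def by (intro compact_UN compact_continuous_image Suc.prems) auto
  define \<I> where "\<I> = {I \<in> ifs_words m. length I = Suc n}"
  have "finite \<I>"
    using finite_lists_length_eq[of "{1..m}" "Suc n"] by (simp add: \<I>_def ifs_words_def lists_eq_set)
  \<comment> \<open>The points sent into \<open>U\<close> by every word of length
    \<open>Suc n\<close>; it is open because there are finitely many such words.\<close>
  define V where "V = (\<Inter>I\<in>\<I>. ifs_word_map f I -` U)"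
  have "open (ifs_word_map f I -` U)" if "I \<in> \<I>" for I
    using continuous_on_ifs_word_map[OF ifs] that U unfolding \<I>_def
    by (intro open_vimage) auto
  then have "open V"
    unfolding V_def using \<open>finite \<I>\<close> by (intro open_INT) auto
  moreover have "H \<subseteq> V"
  proof -
    have "ifs_word_map f I (f i w) \<in> U" if "I \<in> \<I>" "i \<in> {1..m}" "w \<in> W" for I i w
      using Suc.prems(2)[of "i # I"] that
      by (auto simp: \<I>_def ifs_words_def ifs_word_map_Cons image_subset_iff)
    then show ?thesis unfolding H_def V_def by blast
  qed
  ultimately obtain W' where W': "compact W'" "H \<subseteq> interior W'" "W' \<subseteq> V"
    using compact_neighbourhood_within[OF lc \<open>compact H\<close>] by blast
  have "ifs_word_map f I ` W' \<subseteq> U" if "I \<in> ifs_words m" "length I = Suc n" for I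
    using W'(3) that unfolding V_def \<I>_def by blast
  then obtain Q where Q: "compact Q" "W' \<subseteq> Q" "\<forall>i\<in>{1..m}. f i ` Q \<subseteq> interior Q \<union> U"
    using Suc.IH[OF W'(1)] by blast
  have "f i ` (W \<union> Q) \<subseteq> interior (W \<union> Q) \<union> U" if i: "i \<in> {1..m}" for i
  proof -
    have "f i ` W \<subseteq> interior W'" using W'(2) i H_def by blast
    also have "\<dots> \<subseteq> interior (W \<union> Q)" using Q(2) by (intro interior_mono) auto
    finally have "f i ` W \<subseteq> interior (W \<union> Q)" .
    moreover have "f i ` Q \<subseteq> interior Q \<union> U" using Q i by blast
    moreover have "interior Q \<subseteq> interior (W \<union> Q)" by (intro interior_mono) auto
    ultimately show ?thesis by blast
  qed
  then show ?case using Q(1) Suc.prems(1) by (intro exI[of _ "W \<union> Q"]) auto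
qed

text \<open>A compact neighbourhood \<open>W\<close> of the attractor is attracted, so all words of
  some fixed length send \<open>W\<close> into its own interior.
  \<open>trapping_region_of_words\<close> passes from these words to the single maps.\<close>

lemma trapping_region:
  fixes f :: "nat \<Rightarrow> 'a::metric_space \<Rightarrow> 'a"
  assumes lc: "locally_compact_space (euclidean :: 'a topology)" and ifs: "is_ifs m f"
    and "compact_dynamics m f"
  obtains Q where "compact Q" "x \<in> Q" "\<And>i. i \<in> {1..m} \<Longrightarrow> f i ` Q \<subseteq> interior Q"
proof -
  obtain A where A: "compact A" "\<And>K. compact K \<Longrightarrow> attracts m f A K"
    using assms(3) unfolding compact_dynamics_def global_attractor_def by blast
  \<comment> \<open>The point \<open>x\<close> is added to the attractor only to have it in
    \<open>W\<close>, and so in \<open>Q\<close>.\<close>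
  obtain W where W: "compact W" "insert x A \<subseteq> interior W"
    using compact_neighbourhood[OF lc, of "insert x A"] A(1) by auto
  obtain \<epsilon> where \<epsilon>: "\<epsilon> > 0" "(\<Union>a\<in>A. ball a \<epsilon>) \<subseteq> interior W"
    using compact_subset_open_imp_ball_epsilon_subset[of A "interior W"] A(1) W(2) by auto
  have nbhd: "set_nbhd \<epsilon> A \<subseteq> interior W"
  proof
    fix z assume "z \<in> set_nbhd \<epsilon> A"
    then have "A \<noteq> {}" "infdist z A < \<epsilon>" by (auto simp: set_nbhd_def)
    then obtain a where "a \<in> A" "dist z a < \<epsilon>"
      using cInf_lessD[of "dist z ` A" \<epsilon>] by (auto simp: infdist_notempty)
    then have "z \<in> ball a \<epsilon>" by (simp add: dist_commute)
    then show "z \<in> interior W" using \<epsilon>(2) \<open>a \<in> A\<close> by blast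
  qed
  obtain \<tau> where \<tau>: "\<tau> > 0" "\<forall>I\<in>ifs_words m. length I \<ge> \<tau> \<longrightarrow> ifs_word_map f I ` W \<subseteq> set_nbhd \<epsilon> A"
    using A(2)[OF W(1)] \<epsilon>(1) unfolding attracts_def by blast
  obtain n where n: "\<tau> = Suc n" using \<tau>(1) gr0_implies_Suc by blast
  have "ifs_word_map f I ` W \<subseteq> interior W" if "I \<in> ifs_words m" "length I = Suc n" for I
  proof -
    have "ifs_word_map f I ` W \<subseteq> set_nbhd \<epsilon> A" using \<tau>(2) that n by auto
    then show ?thesis using nbhd by (rule subset_trans)
  qed
  then have "\<exists>Q. compact Q \<and> W \<subseteq> Q \<and> (\<forall>i\<in>{1..m}. f i ` Q \<subseteq> interior Q \<union> interior W)"
    by (rule trapping_region_of_words[OF lc ifs open_interior W(1)])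
  then obtain Q where Q: "compact Q" "W \<subseteq> Q"
    "\<forall>i\<in>{1..m}. f i ` Q \<subseteq> interior Q \<union> interior W"
    by (elim exE conjE)
  have "interior W \<subseteq> interior Q" using Q(2) by (rule interior_mono)
  then have "f i ` Q \<subseteq> interior Q" if "i \<in> {1..m}" for i
    using Q(3) that by blast
  moreover have "x \<in> Q" using W(2) Q(2) interior_subset by blast
  ultimately show ?thesis using that Q(1) by blast
qed

section \<open>Lyapunov functions and recurrence\<close>

text \<open>Each value is taken at a representative of a node. It is chosen in
  \<open>N \<inter> Q\<close>, since a node may leave \<open>Q\<close> and \<open>L\<close> is known
  to be constant only on the part inside.\<close>

lemma countable_image_recurrent:
  fixes L :: "'a \<Rightarrow> 'b"
  assumes nodes: "countable (stream_nodes m f S)" and S: "refl S"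
    and const: "\<And>u v. u \<in> Q \<Longrightarrow> v \<in> Q \<Longrightarrow> (u, v) \<in> stream_equiv S \<Longrightarrow> L u = L v"
  shows "countable (L ` (stream_recurrent m f S \<inter> Q))"
proof (rule countable_subset)
  let ?R = "stream_recurrent m f S"
  let ?g = "\<lambda>N. L (SOME w. w \<in> N \<inter> Q)"
  show "countable (?g ` stream_nodes m f S)" using nodes by (rule countable_image)
  show "L ` (?R \<inter> Q) \<subseteq> ?g ` stream_nodes m f S"
  proof (rule image_subsetI)
    fix z assume z: "z \<in> ?R \<inter> Q"
    define N where "N = (stream_equiv S \<inter> ?R \<times> ?R) `` {z}"
    have "N \<in> stream_nodes m f S"
      unfolding stream_nodes_def N_def using z by (intro quotientI) simp
    have "z \<in> N \<inter> Q"
      using z S unfolding N_def stream_equiv_def by (auto dest: reflD)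
    then have "(SOME w. w \<in> N \<inter> Q) \<in> N \<inter> Q" by (rule someI)
    then have "L z = ?g N" using const z unfolding N_def by blast
    then show "L z \<in> ?g ` stream_nodes m f S" using \<open>N \<in> stream_nodes m f S\<close> by blast
  qed
qed

theorem theorem6:
  fixes f :: "nat \<Rightarrow> 'a::metric_space \<Rightarrow> 'a" and m :: nat
  assumes "separable_space (euclidean :: 'a topology)"
    and "locally_compact_space (euclidean :: 'a topology)"
    and "is_ifs m f"
    and "compact_dynamics m f"
    and "countable (stream_nodes m f (smallest_stream m f))"
  shows "smallest_stream m f = chain_stream m f"
proof
  show "smallest_stream m f \<subseteq> chain_stream m f"
    using is_stream_chain_stream[OF assms(3)] unfolding smallest_stream_def by blast
next
  define S where "S = smallest_stream m f"
  have S: "refl S" "trans S" "closed S" and orbit: "orbit_relation m f \<subseteq> S"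
    using is_stream_smallest_stream[of m f] unfolding S_def is_stream_def by auto
  have step: "(z, f i z) \<in> S" if "i \<in> {1..m}" for i z
  proof -
    have "[i] \<in> ifs_words m"
      using that by (simp add: ifs_words_def)
    then have "(z, ifs_word_map f [i] z) \<in> orbit_relation m f"
      unfolding orbit_relation_def by blast
    then show ?thesis using orbit by (auto simp: ifs_word_map_def)
  qed
  show "chain_stream m f \<subseteq> smallest_stream m f"
  proof (rule subrelI, rule ccontr)
    fix x y
    assume xy: "(x, y) \<in> chain_stream m f" and "(x, y) \<notin> smallest_stream m f"
    then have notS: "(x, y) \<notin> S" by (simp add: S_def)
    obtain Q where Q: "compact Q" "x \<in> Q" "\<And>i. i \<in> {1..m} \<Longrightarrow> f i ` Q \<subseteq> interior Q"
      using trapping_region[OF assms(2-4), of x] by metis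
    have "y \<in> Q" by (rule chain_stream_trapped[OF assms(3) Q(1,3,2) xy])
    interpret compact_preorder Q S
      by unfold_locales (use Q S in auto)
    obtain L :: "'a \<Rightarrow> real" where cont: "continuous_on Q L" and less: "L x < L y"
      and mono: "\<forall>u\<in>Q. \<forall>v\<in>Q. (u, v) \<in> S \<longrightarrow> L v \<le> L u \<and> (L u = L v \<longrightarrow> (v, u) \<in> S)"
      using complete_lyapunov[OF Q(2) \<open>y \<in> Q\<close> notS] by (elim exE conjE)
    have "countable (L ` (stream_recurrent m f S \<inter> Q))"
    proof (rule countable_image_recurrent[OF assms(5)[folded S_def] S(1)])
      fix u v assume "u \<in> Q" "v \<in> Q" "(u, v) \<in> stream_equiv S"
      then have "L u \<le> L v" "L v \<le> L u" using mono unfolding stream_equiv_def by blast+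
      then show "L u = L v" by (rule antisym)
    qed
    then have "\<not> {L x<..<L y} \<subseteq> L ` (stream_recurrent m f S \<inter> Q)"
      using uncountable_open_interval[of "L x" "L y"] less countable_subset by blast
    then obtain c where c: "L x < c" "c < L y" "c \<notin> L ` (stream_recurrent m f S \<inter> Q)"
      unfolding subset_iff greaterThanLessThan_iff by blast
    define K where "K = Q \<inter> L -` {..c}"
    have "closed K"
      unfolding K_def by (intro continuous_closed_preimage cont closed_Q) auto
    then have "compact K"
      unfolding K_def using Q(1) by (metis Int_lower1 compact_Int_closed inf.absorb_iff2)
    have "f i ` K \<subseteq> interior K" if i: "i \<in> {1..m}" for i
    proof
      fix w assume "w \<in> f i ` K"
      then obtain z where z: "z \<in> Q" "L z \<le> c" "w = f i z" unfolding K_def by auto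
      have w: "w \<in> interior Q" "w \<in> Q" using Q(3)[OF i] z interior_subset by blast+
      have zw: "(z, w) \<in> S" using step[OF i] z by simp
      have "L w \<le> L z" using mono z w zw by blast
      \<comment> \<open>Equality would force \<open>L z = c\<close> as well, so strictness would
        make \<open>z\<close> and \<open>f i z\<close> equivalent and \<open>z\<close> a recurrent
        point at the level \<open>c\<close>, which was excluded.\<close>
      moreover have "L w \<noteq> c"
      proof
        assume "L w = c"
        then have "L z = c" using \<open>L w \<le> L z\<close> z by simp
        then have "(w, z) \<in> S" using mono z(1) w(2) zw \<open>L w = c\<close> by metis
        then have "z \<in> stream_recurrent m f S"
          unfolding stream_recurrent_def stream_equiv_def using i zw z(3) by blast
        then show False using c(3) \<open>L z = c\<close> z(1) by blast
      qed
      \<comment> \<open>\<open>L\<close> is continuous only on \<open>Q\<close>, so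
        \<open>L < c\<close> alone gives a relatively open set. Intersecting with
        \<open>interior Q\<close>, where \<open>w\<close> lies as \<open>Q\<close> is trapping,
        makes it open in the whole space.\<close>
      ultimately have "w \<in> interior Q \<inter> L -` {..<c}" using w z by auto
      moreover have "open (interior Q \<inter> L -` {..<c})"
        by (intro continuous_open_preimage continuous_on_subset[OF cont] interior_subset) auto
      moreover have "interior Q \<inter> L -` {..<c} \<subseteq> K"
        unfolding K_def using interior_subset by fastforce
      ultimately show "w \<in> interior K" using interior_maximal by blast
    qed
    moreover have "x \<in> K" using Q(2) c(1) K_def by auto
    ultimately have "y \<in> K" using chain_stream_trapped[OF assms(3) \<open>compact K\<close> _ _ xy] by blast
    then show False using c(2) K_def by auto
  qed
qed

end
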